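(* For every $n\ge 2$, the universal positive $n\times n$ Toeplitz matrix $T_n$ generates an extremal ray of the positive cone of $C(S^1)^{(n)}\otimes_{\min}C(S^1)_{(n)}$ and is entangled, i.e. $T_n\notin(C(S^1)^{(n)})_+\otimes_{\rm sep}(C(S^1)_{(n)})_+$.
   Context: $C(S^1)^{(n)}$ is the operator system of all $n\times n$ complex Toeplitz matrices, an operator subsystem of $\mathcal M_n(\mathbb C)$. $C(S^1)_{(n)}$ is the operator subsystem of $C(S^1)$ of all $f(z)=\sum_{\ell=-n+1}^{n-1}\alpha_\ell z^\ell$. Elements of $C(S^1)^{(n)}\otimes C(S^1)_{(n)}$ are viewed as functions on $S^1$ with values in the $n\times n$ Toeplitz matrices; such an element $F$ lies in the positive cone of $C(S^1)^{(n)}\otimes_{\min}C(S^1)_{(n)}$ iff $F(z)$ is positive semidefinite for every $z\in S^1$. $T_n\in C(S^1)^{(n)}\otimes C(S^1)_{(n)}$ is the element whose value at $z\in S^1$ is the matrix $T_n(z)=[z^{k-\ell}]_{k,\ell=0}^{n-1}$. $\mathcal R_+\otimes_{\rm sep}\mathcal T_+=\{\sum_{j=1}^k a_j\otimes b_j : k\in\mathbb N,\ a_j\in\mathcal R_+,\ b_j\in\mathcal T_+\}$. A nonzero element $x$ of a cone $C$ generates an extremal ray of $C$ if $x=y+z$ with $y,z\in C$ implies that $y$ and $z$ are nonnegative scalar multiples of $x$. *)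

theory Defs
  imports Complex_Main "Jordan_Normal_Form.Matrix"
begin

typedef circle = "{z :: complex. cmod z = 1}"
  by (rule exI[of _ 1]) simp

definition positive_semidefinite :: "nat \<Rightarrow> complex mat \<Rightarrow> bool" where
  "positive_semidefinite n A \<longleftrightarrow>
     A \<in> carrier_mat n n \<and> (\<forall>v \<in> carrier_vec n. 0 \<le> (A *\<^sub>v v) \<bullet>c v)"
  \<comment> \<open>the order on \<^typ>\<open>complex\<close> is that of \<^theory>\<open>HOL-Library.Complex_Order\<close>:
      \<^term>\<open>0 \<le> (w :: complex)\<close> says that \<^term>\<open>w\<close> is real and nonnegative\<close>

definition toeplitz_system :: "nat \<Rightarrow> complex mat set" where
  "toeplitz_system n = {mat n n (\<lambda>(k, l). t (int k - int l)) | t :: int \<Rightarrow> complex. True}"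

definition toeplitz_pos :: "nat \<Rightarrow> complex mat set" where
  "toeplitz_pos n = {A \<in> toeplitz_system n. positive_semidefinite n A}"

definition trig_system :: "nat \<Rightarrow> (circle \<Rightarrow> complex) set" where
  "trig_system n =
     {(\<lambda>z. \<Sum>l = - int n + 1..int n - 1. \<alpha> l * Rep_circle z powi l) | \<alpha> :: int \<Rightarrow> complex. True}"

definition trig_pos :: "nat \<Rightarrow> (circle \<Rightarrow> complex) set" where
  "trig_pos n = {f \<in> trig_system n. \<forall>z. 0 \<le> f z}"

text \<open>
  Tensors are identified with matrix-valued functions on the circle, the elementary tensor
  of \<open>A\<close> and \<open>f\<close> being \<open>z \<mapsto> f(z) A\<close>. The set below consists of all finite sums of elementary
  tensors with first factor in \<open>R\<close> and second factor in \<open>T\<close>. For linear spaces \<open>R\<close>, \<open>T\<close> this is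
  their algebraic tensor product; for cones it is the separable cone. The sums are written
  entrywise because matrices of arbitrary size do not form an additive monoid as a type.
\<close>

definition elem_tensor :: "complex mat \<Rightarrow> (circle \<Rightarrow> complex) \<Rightarrow> circle \<Rightarrow> complex mat" where
  "elem_tensor A f = (\<lambda>z. f z \<cdot>\<^sub>m A)"

definition tensor_sums ::
    "nat \<Rightarrow> complex mat set \<Rightarrow> (circle \<Rightarrow> complex) set \<Rightarrow> (circle \<Rightarrow> complex mat) set" where
  "tensor_sums n R T =
     {(\<lambda>z. mat n n (\<lambda>(p, q). \<Sum>j<m. elem_tensor (a j) (b j) z $$ (p, q))) | m a b.
        \<forall>j<(m :: nat). a j \<in> R \<and> b j \<in> T}"

definition tensor_space :: "nat \<Rightarrow> (circle \<Rightarrow> complex mat) set" where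
  "tensor_space n = tensor_sums n (toeplitz_system n) (trig_system n)"

definition min_cone :: "nat \<Rightarrow> (circle \<Rightarrow> complex mat) set" where
  "min_cone n = {F \<in> tensor_space n. \<forall>z. positive_semidefinite n (F z)}"

definition sep_cone :: "nat \<Rightarrow> (circle \<Rightarrow> complex mat) set" where
  "sep_cone n = tensor_sums n (toeplitz_pos n) (trig_pos n)"

definition universal_toeplitz :: "nat \<Rightarrow> circle \<Rightarrow> complex mat" where
  "universal_toeplitz n = (\<lambda>z. mat n n (\<lambda>(k, l). Rep_circle z powi (int k - int l)))"

definition generates_extremal_ray ::
    "nat \<Rightarrow> (circle \<Rightarrow> complex mat) set \<Rightarrow> (circle \<Rightarrow> complex mat) \<Rightarrow> bool" where
  "generates_extremal_ray n C F \<longleftrightarrow>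
     F \<in> C \<and> F \<noteq> (\<lambda>z. 0\<^sub>m n n) \<and>
     (\<forall>G \<in> C. \<forall>H \<in> C. F = (\<lambda>z. G z + H z) \<longrightarrow>
        (\<exists>s t :: real. 0 \<le> s \<and> 0 \<le> t \<and>
           G = (\<lambda>z. complex_of_real s \<cdot>\<^sub>m F z) \<and> H = (\<lambda>z. complex_of_real t \<cdot>\<^sub>m F z)))"

end

theory Submission
  imports Defs "HOL-Computational_Algebra.Polynomial"
begin

text \<open>
  The value of \<open>T\<^sub>n\<close> at \<open>z\<close> is the rank one matrix \<open>w w\<^sup>*\<close> with \<open>w = (1, z, \<dots>, z\<^sup>n\<^sup>-\<^sup>1)\<close>, so an element
  \<open>F\<close> of the cone below \<open>T\<^sub>n\<close> has the form \<open>F(z) = g(z) T\<^sub>n(z)\<close> with \<open>g(z) \<ge> 0\<close>. Both corner entries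
  \<open>g(z) z\<^sup>n\<^sup>-\<^sup>1\<close> and \<open>g(z) z\<^sup>1\<^sup>-\<^sup>n\<close> are trigonometric polynomials with frequencies at most \<open>n - 1\<close> in
  absolute value, which forces \<open>g\<close> to be constant. If \<open>T\<^sub>n\<close> were separable, some nonzero \<open>b(z) A\<close>
  would be such an \<open>F\<close>; but then \<open>b\<close> is constant, while \<open>T\<^sub>n\<close> is not.
\<close>

section \<open>Nonnegative forms and their kernels\<close>

text \<open>Near \<open>e = 0\<close> the linear term dominates and changes sign with
  \<open>e\<close>. The point \<open>e = - a / c\<close> with \<open>c > b\<close> and
  \<open>c > 0\<close> makes this explicit: the value there is \<open>a^2 (b - c) / c^2\<close>,
  negative unless \<open>a = 0\<close>.\<close>

lemma linear_coeff_zero_if_quadratic_nonneg: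
  fixes a b :: real
  assumes "\<And>e. 0 \<le> e * a + e\<^sup>2 * b"
  shows "a = 0"
proof (rule ccontr)
  assume "a \<noteq> 0"
  define c where "c = \<bar>b\<bar> + 1"
  have c: "c > 0" "b < c" by (auto simp: c_def)
  have "0 \<le> (- a / c) * a + (- a / c)\<^sup>2 * b" by (rule assms)
  also have "\<dots> = a\<^sup>2 / c\<^sup>2 * (b - c)"
    using c by (simp add: field_simps power2_eq_square)
  also have "\<dots> < 0"
    using c \<open>a \<noteq> 0\<close> by (intro mult_pos_neg) auto
  finally show False by simp
qed

text \<open>Restricting \<open>t\<close> to the real axis gives \<open>c1 + c2 = 0\<close>, and
  restricting it to the imaginary axis gives \<open>c1 - c2 = 0\<close>. On each axis the expression
  is a quadratic in a real parameter without constant term.\<close>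

lemma linear_coeffs_zero_if_form_nonneg:
  fixes c1 c2 d :: complex
  assumes nonneg: "\<And>t. 0 \<le> t * c1 + cnj t * c2 + t * cnj t * d"
  shows "c1 = 0" "c2 = 0"
proof -
  have sum_zero: "x + y = 0"
    if *: "\<And>e :: real. 0 \<le> of_real e * x + of_real e * y + of_real e * of_real e * d"
    for x y :: complex
  proof -
    have "Re (x + y) = 0"
      using * by (intro linear_coeff_zero_if_quadratic_nonneg[where b = "Re d"])
        (auto simp: less_eq_complex_def algebra_simps power2_eq_square)
    \<comment> \<open>Nonnegativity in the complex order also says that the value is real. At
      \<open>e = 1\<close> and \<open>e = -1\<close> the imaginary parts of the linear term have
      opposite signs, while that of \<open>d\<close> is the same.\<close>
    moreover have "Im (x + y) = 0"
      using *[of 1] *[of "-1"] by (simp add: less_eq_complex_def)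
    ultimately show ?thesis by (simp add: complex_eq_iff)
  qed
  have "c1 + c2 = 0"
    by (rule sum_zero) (use nonneg[of "of_real _"] in simp)
  moreover have "\<i> * c1 + (- \<i> * c2) = 0"
  proof (rule sum_zero)
    fix e :: real
    show "0 \<le> of_real e * (\<i> * c1) + of_real e * (- \<i> * c2) + of_real e * of_real e * d"
      using nonneg[of "of_real e * \<i>"] by (simp add: algebra_simps)
  qed
  hence "\<i> * (c1 - c2) = 0" by (simp add: algebra_simps)
  ultimately show "c1 = 0" "c2 = 0" by auto
qed

text \<open>Expanding the form at \<open>v + t x\<close> leaves no constant term, since the form
  vanishes at \<open>v\<close>; so the coefficients of \<open>t\<close> and of \<open>cnj t\<close>
  must vanish. These are the two mixed terms, and both are obtained at once without first showing
  that \<open>M\<close> is Hermitian.\<close>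

lemma positive_semidefinite_kernel:
  assumes psd: "positive_semidefinite n M"
    and v: "v \<in> carrier_vec n" and x: "x \<in> carrier_vec n"
    and zero: "(M *\<^sub>v v) \<bullet>c v = 0"
  shows "(M *\<^sub>v v) \<bullet>c x = 0" "(M *\<^sub>v x) \<bullet>c v = 0"
proof -
  have M: "M \<in> carrier_mat n n" using psd by (simp add: positive_semidefinite_def)
  have "0 \<le> t * ((M *\<^sub>v x) \<bullet>c v) + cnj t * ((M *\<^sub>v v) \<bullet>c x) + t * cnj t * ((M *\<^sub>v x) \<bullet>c x)" for t
  proof -
    have "(M *\<^sub>v (v + t \<cdot>\<^sub>v x)) \<bullet>c (v + t \<cdot>\<^sub>v x)
      = (M *\<^sub>v v + t \<cdot>\<^sub>v (M *\<^sub>v x)) \<bullet> (conjugate v + cnj t \<cdot>\<^sub>v conjugate x)"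
      using M v x by (simp add: mult_add_distrib_mat_vec[where nr = n and nc = n]
        mult_mat_vec[where nr = n and nc = n] conjugate_add_vec[where n = n] conjugate_smult_vec)
    also have "\<dots> = t * ((M *\<^sub>v x) \<bullet>c v) + cnj t * ((M *\<^sub>v v) \<bullet>c x) + t * cnj t * ((M *\<^sub>v x) \<bullet>c x)"
      using M v x zero
      by (simp add: add_scalar_prod_distrib[where n = n] scalar_prod_add_distrib[where n = n]
        algebra_simps)
    finally show ?thesis
      using psd v x by (metis positive_semidefinite_def add_carrier_vec smult_carrier_vec)
  qed
  from linear_coeffs_zero_if_form_nonneg[OF this]
  show "(M *\<^sub>v v) \<bullet>c x = 0" "(M *\<^sub>v x) \<bullet>c v = 0" by auto
qed

lemma form_eq_sum:
  assumes "A \<in> carrier_mat n n" "v \<in> carrier_vec n"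
  shows "(A *\<^sub>v v) \<bullet>c v = (\<Sum>p<n. \<Sum>q<n. A $$ (p, q) * v $ q * cnj (v $ p))"
  using assms by (simp add: scalar_prod_def sum_distrib_right lessThan_atLeast0)

section \<open>Trigonometric polynomials as ordinary polynomials on the circle\<close>

lemma Rep_circle_nonzero [simp]: "Rep_circle z \<noteq> 0"
  using Rep_circle[of z] by auto

lemma cnj_Rep_circle: "cnj (Rep_circle z) = inverse (Rep_circle z)"
  using Rep_circle[of z]
  by (intro inverse_unique[symmetric]) (simp add: complex_norm_square[symmetric])

text \<open>The circle contains the \<open>m\<close> roots of unity of order \<open>m\<close>; for
  \<open>m\<close> one more than a supposed cardinality this is a contradiction.\<close>

lemma infinite_circle: "infinite (range Rep_circle)"
proof
  assume fin: "finite (range Rep_circle)"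
  define m where "m = Suc (card (range Rep_circle))"
  have "range Rep_circle = {z. cmod z = 1}"
    using type_definition_circle by (rule type_definition.Rep_range)
  moreover have "cmod z = 1" if "z ^ m = 1" for z
    using that power_eq_1_iff[of z m] by (simp add: m_def)
  ultimately have "{z. z ^ m = 1} \<subseteq> range Rep_circle" by auto
  hence "card {z :: complex. z ^ m = 1} \<le> card (range Rep_circle)"
    by (rule card_mono[OF fin])
  thus False using card_roots_unity_eq[of m] by (simp add: m_def)
qed

lemma poly_eq_if_eq_on_circle:
  fixes p q :: "complex poly"
  assumes "\<And>z. poly p (Rep_circle z) = poly q (Rep_circle z)"
  shows "p = q"
proof (rule ccontr)
  assume "p \<noteq> q"
  hence "finite {x. poly (p - q) x = 0}" by (intro poly_roots_finite) simp
  moreover have "range Rep_circle \<subseteq> {x. poly (p - q) x = 0}" using assms by auto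
  ultimately show False using infinite_circle finite_subset by blast
qed

text \<open>Multiplication by \<open>z^(n-1)\<close> shifts the frequencies from
  \<open>-(n-1), ..., n-1\<close> to \<open>0, ..., 2(n-1)\<close>, so that degree arguments become
  available.\<close>

lemma trig_system_poly:
  assumes "f \<in> trig_system n"
  shows "\<exists>p. degree p \<le> 2 * (n - 1) \<and>
    (\<forall>z. Rep_circle z ^ (n - 1) * f z = poly p (Rep_circle z))"
proof -
  obtain \<alpha> where f: "f = (\<lambda>z. \<Sum>l = - int n + 1..int n - 1. \<alpha> l * Rep_circle z powi l)"
    using assms by (auto simp: trig_system_def)
  define p where
    "p = (\<Sum>l = - int n + 1..int n - 1. monom (\<alpha> l) (nat (l + int n - 1)))"
  have "degree p \<le> 2 * (n - 1)"
    unfolding p_def by (intro degree_sum_le) (auto intro!: order.trans[OF degree_monom_le])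
  moreover have "Rep_circle z ^ (n - 1) * f z = poly p (Rep_circle z)" for z
    unfolding f p_def sum_distrib_left poly_sum poly_monom
  proof (rule sum.cong)
    fix l assume l: "l \<in> {- int n + 1..int n - 1}"
    \<comment> \<open>The range of \<open>l\<close> gives \<open>l + n - 1 \<ge> 0\<close> and,
      being nonempty, \<open>n \<ge> 1\<close>; hence neither \<open>nat\<close> nor the subtraction
      \<open>n - 1\<close> truncates.\<close>
    have "Rep_circle z ^ nat (l + int n - 1) = Rep_circle z powi (int (n - 1) + l)"
      using l by (auto simp flip: power_int_of_nat intro!: arg_cong[where f = "power_int _"])
    thus "Rep_circle z ^ (n - 1) * (\<alpha> l * Rep_circle z powi l) =
        \<alpha> l * Rep_circle z ^ nat (l + int n - 1)"
      by (simp add: power_int_add)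
  qed simp
  ultimately show ?thesis by blast
qed

text \<open>Each fixed entry is a linear combination of the scalar functions \<open>b j\<close>,
  with the entries of the matrices \<open>a j\<close> as coefficients, so the frequency shift
  applies summand by summand.\<close>

lemma tensor_space_entry_poly:
  assumes "F \<in> tensor_space n" "p < n" "q < n"
  shows "\<exists>P. degree P \<le> 2 * (n - 1) \<and>
    (\<forall>z. Rep_circle z ^ (n - 1) * F z $$ (p, q) = poly P (Rep_circle z))"
proof -
  obtain m :: nat and a b
    where F: "F = (\<lambda>z. mat n n (\<lambda>(p, q). \<Sum>j<m. elem_tensor (a j) (b j) z $$ (p, q)))"
      and ab: "\<And>j. j < m \<Longrightarrow> a j \<in> toeplitz_system n" "\<And>j. j < m \<Longrightarrow> b j \<in> trig_system n"
    using assms(1) unfolding tensor_space_def tensor_sums_def by auto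
  have "\<forall>j. \<exists>P. j < m \<longrightarrow> degree P \<le> 2 * (n - 1) \<and>
    (\<forall>z. Rep_circle z ^ (n - 1) * b j z = poly P (Rep_circle z))"
    using trig_system_poly[OF ab(2)] by blast
  then obtain P where P: "\<And>j. j < m \<Longrightarrow> degree (P j) \<le> 2 * (n - 1)"
    "\<And>j z. j < m \<Longrightarrow> Rep_circle z ^ (n - 1) * b j z = poly (P j) (Rep_circle z)"
    by metis
  have car: "a j \<in> carrier_mat n n" if "j < m" for j
    using ab(1)[OF that] by (auto simp: toeplitz_system_def)
  show ?thesis
  proof (intro exI conjI allI)
    show "degree (\<Sum>j<m. smult (a j $$ (p, q)) (P j)) \<le> 2 * (n - 1)"
      using P(1) by (intro degree_sum_le) (auto intro: order.trans[OF degree_smult_le])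
    show "Rep_circle z ^ (n - 1) * F z $$ (p, q) =
        poly (\<Sum>j<m. smult (a j $$ (p, q)) (P j)) (Rep_circle z)" for z
      unfolding F using assms(2,3) carrier_matD[OF car]
      by (auto simp: elem_tensor_def poly_sum sum_distrib_left P(2)[symmetric] mult_ac
        intro!: sum.cong)
  qed
qed

section \<open>Positivity of the universal Toeplitz matrix and the elements below it\<close>

lemma universal_toeplitz_carrier [simp]: "universal_toeplitz n z \<in> carrier_mat n n"
  by (simp add: universal_toeplitz_def)

lemma universal_toeplitz_index:
  "p < n \<Longrightarrow> q < n \<Longrightarrow> universal_toeplitz n z $$ (p, q) = Rep_circle z powi (int p - int q)"
  by (simp add: universal_toeplitz_def)

text \<open>The form at \<open>v\<close> is the squared modulus of \<open>s\<close>, the pairing of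
  \<open>v\<close> with \<open>(1, z, ..., z^(n-1))\<close>.\<close>

lemma universal_toeplitz_psd: "positive_semidefinite n (universal_toeplitz n z)"
proof -
  have "0 \<le> (universal_toeplitz n z *\<^sub>v v) \<bullet>c v" if v: "v \<in> carrier_vec n" for v
  proof -
    define s where "s = (\<Sum>q<n. v $ q * cnj (Rep_circle z ^ q))"
    have "(universal_toeplitz n z *\<^sub>v v) \<bullet>c v
      = (\<Sum>p<n. \<Sum>q<n. (v $ q * cnj (Rep_circle z ^ q)) * cnj (v $ p * cnj (Rep_circle z ^ p)))"
      unfolding form_eq_sum[OF universal_toeplitz_carrier v]
      by (intro sum.cong refl)
        (simp add: universal_toeplitz_index power_int_diff cnj_Rep_circle field_simps)
    also have "\<dots> = cnj s * s"
      unfolding s_def cnj_sum sum_product by (simp add: mult_ac)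
    also have "\<dots> = of_real ((cmod s)\<^sup>2)"
      by (simp only: complex_norm_square mult.commute)
    finally show ?thesis by (simp add: less_eq_complex_def)
  qed
  thus ?thesis by (simp add: positive_semidefinite_def)
qed

text \<open>On the kernel of the rank one matrix the form of \<open>M\<close> is squeezed to zero,
  so \<open>M\<close> pairs to zero with these vectors on either side. This ties every column of
  \<open>M\<close> to column 0 and every row to row 0, leaving only the scalar
  \<open>M $$ (0, 0)\<close> free.\<close>

lemma universal_toeplitz_dominates_pointwise:
  assumes psd: "positive_semidefinite n M"
    and le: "\<And>v. v \<in> carrier_vec n \<Longrightarrow>
      (M *\<^sub>v v) \<bullet>c v \<le> (universal_toeplitz n z *\<^sub>v v) \<bullet>c v"
    and ij: "i < n" "j < n"
  shows "M $$ (i, j) = M $$ (0, 0) * Rep_circle z powi (int i - int j)"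
proof -
  let ?w = "Rep_circle z"
  have M: "M \<in> carrier_mat n n" using psd by (simp add: positive_semidefinite_def)
  have kernel: "?w ^ k * M $$ (l, k) = M $$ (l, 0)" "M $$ (k, l) = ?w ^ k * M $$ (0, l)"
    if kl: "k < n" "l < n" for k l
  proof -
    \<comment> \<open>orthogonal to \<open>(1, w, \<dots>)\<close>, hence in the kernel of \<open>T\<^sub>n\<close>\<close>
    define v where "v = ?w ^ k \<cdot>\<^sub>v unit_vec n k - unit_vec n 0"
    have v: "v \<in> carrier_vec n" by (simp add: v_def)
    have apply_v: "(A *\<^sub>v v) $ p = ?w ^ k * A $$ (p, k) - A $$ (p, 0)"
      if "A \<in> carrier_mat n n" "p < n" for A p
    proof -
      have "(A *\<^sub>v v) $ p = ?w ^ k * (row A p \<bullet> unit_vec n k) - row A p \<bullet> unit_vec n 0"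
        using that kl by (simp add: v_def scalar_prod_minus_distrib[where n = n])
      thus ?thesis using that kl by simp
    qed
    have "universal_toeplitz n z *\<^sub>v v = 0\<^sub>v n"
    proof (rule eq_vecI)
      fix p assume "p < dim_vec (0\<^sub>v n :: complex vec)"
      thus "(universal_toeplitz n z *\<^sub>v v) $ p = 0\<^sub>v n $ p"
        using kl by (subst apply_v) (auto simp: universal_toeplitz_index power_int_diff)
    qed (simp add: universal_toeplitz_def)
    hence "(M *\<^sub>v v) \<bullet>c v \<le> 0" using le[OF v] v by simp
    moreover have "0 \<le> (M *\<^sub>v v) \<bullet>c v" using psd v by (simp add: positive_semidefinite_def)
    ultimately have zero: "(M *\<^sub>v v) \<bullet>c v = 0" by (rule antisym)
    have e: "unit_vec n l \<in> carrier_vec n" by simp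
    note ker = positive_semidefinite_kernel[OF psd v e zero]
    have "conjugate (unit_vec n l) = (unit_vec n l :: complex vec)"
      by (rule eq_vecI) (auto simp: unit_vec_def)
    hence "(M *\<^sub>v v) $ l = 0"
      using ker(1) M kl by simp
    thus "?w ^ k * M $$ (l, k) = M $$ (l, 0)" using apply_v[OF M kl(2)] by simp
    \<comment> \<open>The pairing with \<open>v\<close> in the second slot gives the row relation.
      The conjugation there turns \<open>?w ^ k\<close> into its inverse.\<close>
    have "M *\<^sub>v unit_vec n l = col M l"
      using M kl by (intro eq_vecI) auto
    hence "0 = col M l \<bullet> conjugate v" using ker(2) by simp
    also have "conjugate v = cnj (?w ^ k) \<cdot>\<^sub>v unit_vec n k - unit_vec n 0"
      by (rule eq_vecI) (auto simp: v_def unit_vec_def)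
    also have "col M l \<bullet> \<dots> = cnj (?w ^ k) * M $$ (k, l) - M $$ (0, l)"
      using M kl by (simp add: scalar_prod_minus_distrib[where n = n])
    finally show "M $$ (k, l) = ?w ^ k * M $$ (0, l)"
      by (simp add: cnj_Rep_circle field_simps)
  qed
  \<comment> \<open>Both sides equal \<open>M $$ (i, 0)\<close>: first move along row
    \<open>i\<close> to column 0, then up that column to row 0.\<close>
  have "?w ^ j * M $$ (i, j) = ?w ^ i * M $$ (0, 0)"
    using kernel(1)[of j i] kernel(2)[of i 0] ij by simp
  thus ?thesis by (simp add: power_int_diff field_simps)
qed

text \<open>Pointwise only a scalar function \<open>g(z) = F z $$ (0, 0)\<close> remains. The two
  opposite corners bound its frequencies from below and from above by 0.\<close>

lemma universal_toeplitz_dominates: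
  assumes n: "n \<ge> 1" and F: "F \<in> tensor_space n"
    and psd: "\<And>z. positive_semidefinite n (F z)"
    and le: "\<And>z v. v \<in> carrier_vec n \<Longrightarrow>
      (F z *\<^sub>v v) \<bullet>c v \<le> (universal_toeplitz n z *\<^sub>v v) \<bullet>c v"
  shows "\<exists>s :: real. 0 \<le> s \<and> F = (\<lambda>z. complex_of_real s \<cdot>\<^sub>m universal_toeplitz n z)"
proof -
  define N where "N = n - 1"
  have N: "N < n" "0 < n" using n by (auto simp: N_def)
  have car: "F z \<in> carrier_mat n n" for z using psd by (simp add: positive_semidefinite_def)
  have F_eq: "F z $$ (i, j) = F z $$ (0, 0) * Rep_circle z powi (int i - int j)"
    if "i < n" "j < n" for z i j
    by (rule universal_toeplitz_dominates_pointwise[OF psd le that])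
  obtain Q where Q: "degree Q \<le> 2 * N"
    "\<And>z. Rep_circle z ^ N * F z $$ (N, 0) = poly Q (Rep_circle z)"
    using tensor_space_entry_poly[OF F N] unfolding N_def by blast
  obtain R where R: "\<And>z. Rep_circle z ^ N * F z $$ (0, N) = poly R (Rep_circle z)"
    using tensor_space_entry_poly[OF F N(2,1)] unfolding N_def by blast
  \<comment> \<open>In the corner \<open>(0, N)\<close> the factor \<open>z^(-N)\<close> cancels the
    shift \<open>z^N\<close>, so \<open>g\<close> itself is a polynomial in \<open>z\<close>. In the
    corner \<open>(N, 0)\<close> the two factors combine to \<open>z^(2N)\<close>.\<close>
  have F00: "F z $$ (0, 0) = poly R (Rep_circle z)" for z
    using R[of z] F_eq[OF N(2,1), of z] by (simp add: power_int_minus field_simps)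
  have "Q = monom 1 (2 * N) * R"
  proof (rule poly_eq_if_eq_on_circle)
    fix z
    show "poly Q (Rep_circle z) = poly (monom 1 (2 * N) * R) (Rep_circle z)"
      using Q(2)[of z] F_eq[OF N, of z]
      by (simp add: F00 poly_monom mult_2_right power_add mult_ac)
  qed
  \<comment> \<open>A nonzero \<open>R\<close> would give \<open>Q\<close> the degree
    \<open>2N + degree R\<close>, while the bound on \<open>Q\<close> is \<open>2N\<close>.\<close>
  hence "degree R = 0"
    using Q(1) by (cases "R = 0") (auto simp: degree_mult_eq degree_monom_eq monom_eq_0_iff)
  then obtain c where "R = [:c:]" by (rule degree_eq_zeroE)
  hence F00_c: "F z $$ (0, 0) = c" for z using F00 by simp
  have "0 \<le> c"
  proof -
    fix z
    have "0 \<le> (F z *\<^sub>v unit_vec n 0) \<bullet>c unit_vec n 0"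
      using psd[of z] by (simp add: positive_semidefinite_def)
    also have "conjugate (unit_vec n 0) = (unit_vec n 0 :: complex vec)"
      by (rule eq_vecI) (auto simp: unit_vec_def)
    also have "(F z *\<^sub>v unit_vec n 0) \<bullet> \<dots> = c"
      using car[of z] N F00_c[of z] by simp
    finally show ?thesis .
  qed
  hence "0 \<le> Re c" "c = of_real (Re c)" by (auto simp: less_eq_complex_def complex_eq_iff)
  moreover have "F = (\<lambda>z. c \<cdot>\<^sub>m universal_toeplitz n z)"
  proof (intro ext eq_matI)
    fix z i j
    assume "i < dim_row (c \<cdot>\<^sub>m universal_toeplitz n z)" "j < dim_col (c \<cdot>\<^sub>m universal_toeplitz n z)"
    thus "F z $$ (i, j) = (c \<cdot>\<^sub>m universal_toeplitz n z) $$ (i, j)"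
      using F_eq[of i j z] F00_c by (simp add: universal_toeplitz_def)
  qed (use car in \<open>auto simp: universal_toeplitz_def\<close>)
  ultimately show ?thesis by metis
qed

section \<open>Extremality in the minimal cone\<close>

text \<open>The decomposition is by diagonals: \<open>a j\<close> is the indicator matrix of the
  diagonal \<open>k - l = d j\<close>, paired with the monomial \<open>z^(d j)\<close>. The
  \<open>2n - 1\<close> indices \<open>j\<close> correspond to the diagonals
  \<open>-n+1, ..., n-1\<close>.\<close>

lemma universal_toeplitz_in_tensor_space: "universal_toeplitz n \<in> tensor_space n"
proof -
  define d :: "nat \<Rightarrow> int" where "d j = int j - int n + 1" for j
  define a :: "nat \<Rightarrow> complex mat"
    where "a j = mat n n (\<lambda>(k, l). (\<lambda>i. of_bool (i = d j)) (int k - int l))" for j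
  define b :: "nat \<Rightarrow> circle \<Rightarrow> complex" where "b j z = Rep_circle z powi d j" for j z
  have "universal_toeplitz n =
    (\<lambda>z. mat n n (\<lambda>(p, q). \<Sum>j<2 * n - 1. elem_tensor (a j) (b j) z $$ (p, q)))"
  proof (intro ext eq_matI)
    fix z p q
    assume "p < dim_row (mat n n (\<lambda>(p, q). \<Sum>j<2 * n - 1. elem_tensor (a j) (b j) z $$ (p, q)))"
      "q < dim_col (mat n n (\<lambda>(p, q). \<Sum>j<2 * n - 1. elem_tensor (a j) (b j) z $$ (p, q)))"
    hence pq: "p < n" "q < n" by auto
    \<comment> \<open>The index \<open>p + n - 1 - q\<close> is the solution of
      \<open>d j = p - q\<close>; it does not truncate because \<open>q < n\<close>.\<close>
    have "(\<Sum>j<2 * n - 1. elem_tensor (a j) (b j) z $$ (p, q))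
      = (\<Sum>j<2 * n - 1. if j = p + n - 1 - q then Rep_circle z powi (int p - int q) else 0)"
      using pq by (intro sum.cong) (auto simp: elem_tensor_def a_def b_def d_def)
    also have "\<dots> = Rep_circle z powi (int p - int q)"
      using pq by (subst sum.delta) auto
    finally show "universal_toeplitz n z $$ (p, q) =
      mat n n (\<lambda>(p, q). \<Sum>j<2 * n - 1. elem_tensor (a j) (b j) z $$ (p, q)) $$ (p, q)"
      using pq by (simp add: universal_toeplitz_index)
  qed (auto simp: universal_toeplitz_def)
  moreover have "a j \<in> toeplitz_system n" for j
    unfolding toeplitz_system_def a_def
    by (intro CollectI exI[of _ "\<lambda>i. of_bool (i = d j)"]) simp
  moreover have "b j \<in> trig_system n" if "j < 2 * n - 1" for j
  proof -
    have "b j z = (\<Sum>l = - int n + 1..int n - 1. of_bool (l = d j) * Rep_circle z powi l)" for z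
    proof -
      have "(\<Sum>l = - int n + 1..int n - 1. of_bool (l = d j) * Rep_circle z powi l)
        = (\<Sum>l = - int n + 1..int n - 1. if l = d j then Rep_circle z powi d j else 0)"
        by (intro sum.cong) auto
      thus ?thesis using that by (auto simp: b_def d_def)
    qed
    hence "b j = (\<lambda>z. \<Sum>l = - int n + 1..int n - 1. of_bool (l = d j) * Rep_circle z powi l)"
      by blast
    thus ?thesis unfolding trig_system_def
      by (intro CollectI exI[of _ "\<lambda>l. of_bool (l = d j)"]) auto
  qed
  ultimately show ?thesis
    unfolding tensor_space_def tensor_sums_def by blast
qed

lemma universal_toeplitz_nonzero:
  assumes "n \<ge> 1"
  shows "universal_toeplitz n \<noteq> (\<lambda>z. 0\<^sub>m n n)"
proof
  assume "universal_toeplitz n = (\<lambda>z. 0\<^sub>m n n)"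
  hence "universal_toeplitz n z $$ (0, 0) = 0\<^sub>m n n $$ (0, 0)" for z by metis
  thus False using assms by (simp add: universal_toeplitz_index)
qed

text \<open>If \<open>T_n = G + H\<close> in the cone, nonnegativity of the form of \<open>H\<close>
  puts \<open>G\<close> below \<open>T_n\<close>, and conversely.\<close>

lemma universal_toeplitz_extremal:
  assumes n: "n \<ge> 1"
  shows "generates_extremal_ray n (min_cone n) (universal_toeplitz n)"
proof -
  have part: "\<exists>s :: real. 0 \<le> s \<and> G = (\<lambda>z. complex_of_real s \<cdot>\<^sub>m universal_toeplitz n z)"
    if G: "G \<in> min_cone n" and H: "H \<in> min_cone n"
      and sum: "\<And>z. universal_toeplitz n z = G z + H z" for G H
  proof (rule universal_toeplitz_dominates[OF n])
    fix z and v :: "complex vec" assume v: "v \<in> carrier_vec n"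
    have psd: "positive_semidefinite n (G z)" "positive_semidefinite n (H z)"
      using G H by (auto simp: min_cone_def)
    have "G z \<in> carrier_mat n n" "H z \<in> carrier_mat n n"
      using psd by (auto simp: positive_semidefinite_def)
    moreover from this have "G z *\<^sub>v v \<in> carrier_vec n" "H z *\<^sub>v v \<in> carrier_vec n"
      using v by auto
    ultimately have "(universal_toeplitz n z *\<^sub>v v) \<bullet>c v = (G z *\<^sub>v v) \<bullet>c v + (H z *\<^sub>v v) \<bullet>c v"
      using v
      by (simp add: sum add_mult_distrib_mat_vec[where nr = n and nc = n]
        add_scalar_prod_distrib[where n = n])
    moreover have "0 \<le> (H z *\<^sub>v v) \<bullet>c v"
      using psd(2) v by (simp add: positive_semidefinite_def)
    ultimately show "(G z *\<^sub>v v) \<bullet>c v \<le> (universal_toeplitz n z *\<^sub>v v) \<bullet>c v" by simp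
  qed (use G in \<open>auto simp: min_cone_def\<close>)
  \<comment> \<open>Matrix addition commutes only for matching dimensions. With this,
    \<open>part\<close> applies with the roles of \<open>G\<close> and \<open>H\<close>
    exchanged.\<close>
  have comm: "G z + H z = H z + G z" if "G \<in> min_cone n" "H \<in> min_cone n" for G H z
    using that
    by (intro comm_add_mat[where nr = n and nc = n]) (auto simp: min_cone_def positive_semidefinite_def)
  show ?thesis
    unfolding generates_extremal_ray_def
  proof (intro conjI ballI impI)
    show "universal_toeplitz n \<in> min_cone n"
      by (simp add: min_cone_def universal_toeplitz_in_tensor_space universal_toeplitz_psd)
    show "universal_toeplitz n \<noteq> (\<lambda>z. 0\<^sub>m n n)"
      using n by (rule universal_toeplitz_nonzero)
    fix G H
    assume GH: "G \<in> min_cone n" "H \<in> min_cone n"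
      and sum: "universal_toeplitz n = (\<lambda>z. G z + H z)"
    have "\<And>z. universal_toeplitz n z = G z + H z" by (simp add: sum)
    moreover have "\<And>z. universal_toeplitz n z = H z + G z" using GH by (simp add: sum comm)
    ultimately show "\<exists>s t :: real. 0 \<le> s \<and> 0 \<le> t \<and>
        G = (\<lambda>z. complex_of_real s \<cdot>\<^sub>m universal_toeplitz n z) \<and>
        H = (\<lambda>z. complex_of_real t \<cdot>\<^sub>m universal_toeplitz n z)"
      using part[OF GH] part[OF GH(2,1)] by blast
  qed
qed

section \<open>Entanglement\<close>

lemma elem_tensor_in_tensor_space:
  assumes "A \<in> toeplitz_system n" "f \<in> trig_system n"
  shows "elem_tensor A f \<in> tensor_space n"
proof -
  have "A \<in> carrier_mat n n" using assms(1) by (auto simp: toeplitz_system_def)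
  hence "elem_tensor A f = (\<lambda>z. mat n n (\<lambda>(p, q). \<Sum>j<1::nat. elem_tensor A f z $$ (p, q)))"
    by (intro ext eq_matI) (auto simp: elem_tensor_def)
  thus ?thesis
    unfolding tensor_space_def tensor_sums_def using assms
    by (intro CollectI exI[of _ 1] exI[of _ "\<lambda>_. A"] exI[of _ "\<lambda>_. f"]) auto
qed

text \<open>Every summand of a separable decomposition lies below \<open>T_n\<close>, hence is a
  multiple \<open>s T_n\<close>. A product \<open>b(z) A\<close> of this form with
  \<open>s \<noteq> 0\<close> is impossible: the diagonal makes \<open>b\<close> constant, the first
  subdiagonal does not.\<close>

lemma universal_toeplitz_entangled:
  assumes n: "n \<ge> 2"
  shows "universal_toeplitz n \<notin> sep_cone n"
proof
  assume "universal_toeplitz n \<in> sep_cone n"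
  then obtain m :: nat and a b where T: "universal_toeplitz n =
      (\<lambda>z. mat n n (\<lambda>(p, q). \<Sum>j<m. elem_tensor (a j) (b j) z $$ (p, q)))"
    and ab: "\<And>j. j < m \<Longrightarrow> a j \<in> toeplitz_pos n" "\<And>j. j < m \<Longrightarrow> b j \<in> trig_pos n"
    unfolding sep_cone_def tensor_sums_def by auto
  have car: "a j \<in> carrier_mat n n" if "j < m" for j
    using ab(1)[OF that] by (auto simp: toeplitz_pos_def toeplitz_system_def)
  have form: "(elem_tensor (a j) (b j) z *\<^sub>v v) \<bullet>c v = b j z * ((a j *\<^sub>v v) \<bullet>c v)"
    if "j < m" "v \<in> carrier_vec n" for j z v
    using that car[OF that(1)]
    by (subst (1 2) form_eq_sum[where n = n])
      (auto simp: elem_tensor_def sum_distrib_left mult_ac intro!: sum.cong)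
  have form_nonneg: "0 \<le> (elem_tensor (a j) (b j) z *\<^sub>v v) \<bullet>c v"
    if "j < m" "v \<in> carrier_vec n" for j z v
    unfolding form[OF that] using ab that
    by (auto simp: toeplitz_pos_def trig_pos_def positive_semidefinite_def intro!: mult_nonneg_nonneg)
  have form_T: "(universal_toeplitz n z *\<^sub>v v) \<bullet>c v =
      (\<Sum>j<m. (elem_tensor (a j) (b j) z *\<^sub>v v) \<bullet>c v)" if v: "v \<in> carrier_vec n" for z v
  proof -
    have "(universal_toeplitz n z *\<^sub>v v) \<bullet>c v = (\<Sum>p<n. \<Sum>q<n. \<Sum>j<m.
        elem_tensor (a j) (b j) z $$ (p, q) * v $ q * cnj (v $ p))"
      unfolding form_eq_sum[OF universal_toeplitz_carrier v]
      by (simp add: T sum_distrib_right)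
    also have "\<dots> = (\<Sum>j<m. \<Sum>p<n. \<Sum>q<n.
        elem_tensor (a j) (b j) z $$ (p, q) * v $ q * cnj (v $ p))"
      by (subst (2) sum.swap, subst sum.swap) (rule refl)
    also have "\<dots> = (\<Sum>j<m. (elem_tensor (a j) (b j) z *\<^sub>v v) \<bullet>c v)"
      using car v by (intro sum.cong refl form_eq_sum[symmetric]) (auto simp: elem_tensor_def)
    finally show ?thesis .
  qed
  have multiple: "\<exists>s :: real. elem_tensor (a j) (b j) =
      (\<lambda>z. complex_of_real s \<cdot>\<^sub>m universal_toeplitz n z)" if j: "j < m" for j
  proof -
    have "\<exists>s :: real. 0 \<le> s \<and> elem_tensor (a j) (b j) =
      (\<lambda>z. complex_of_real s \<cdot>\<^sub>m universal_toeplitz n z)"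
    proof (rule universal_toeplitz_dominates)
      show "n \<ge> 1" using n by simp
      show "elem_tensor (a j) (b j) \<in> tensor_space n"
        using ab[OF j] by (intro elem_tensor_in_tensor_space) (auto simp: toeplitz_pos_def trig_pos_def)
      show "positive_semidefinite n (elem_tensor (a j) (b j) z)" for z
        using form_nonneg[OF j] car[OF j]
        by (auto simp: positive_semidefinite_def elem_tensor_def)
      \<comment> \<open>A single term is at most the whole sum, since all terms are
        nonnegative.\<close>
      show "(elem_tensor (a j) (b j) z *\<^sub>v v) \<bullet>c v \<le> (universal_toeplitz n z *\<^sub>v v) \<bullet>c v"
        if v: "v \<in> carrier_vec n" for z v
        unfolding form_T[OF v] using j form_nonneg v by (intro member_le_sum) auto
    qed
    thus ?thesis by blast
  qed
  have index: "elem_tensor (a j) (b j) z $$ (p, q) = b j z * a j $$ (p, q)"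
    if "j < m" "p < n" "q < n" for j z p q
    using that car[OF that(1)] by (auto simp: elem_tensor_def)
  \<comment> \<open>Two points suffice to refute constancy: \<open>z\<close> takes the values
    \<open>1\<close> and \<open>-1\<close>, so \<open>s z\<close> changes sign.\<close>
  define z1 where "z1 = Abs_circle 1"
  define z2 where "z2 = Abs_circle (- 1)"
  have z: "Rep_circle z1 = 1" "Rep_circle z2 = - 1"
    by (auto simp: z1_def z2_def Abs_circle_inverse)
  have "universal_toeplitz n z1 $$ (0, 0) = 1" using n by (simp add: universal_toeplitz_index)
  hence "(\<Sum>j<m. elem_tensor (a j) (b j) z1 $$ (0, 0)) = 1" using n by (simp add: T)
  then obtain j where j: "j < m" "elem_tensor (a j) (b j) z1 $$ (0, 0) \<noteq> 0"
    by (metis (no_types, lifting) lessThan_iff sum.neutral zero_neq_one)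
  obtain s :: real where s: "elem_tensor (a j) (b j) =
      (\<lambda>z. complex_of_real s \<cdot>\<^sub>m universal_toeplitz n z)" using multiple[OF j(1)] by blast
  have entry: "b j z * a j $$ (p, q) = of_real s * Rep_circle z powi (int p - int q)"
    if "p < n" "q < n" for z p q
    using index[OF j(1) that, of z] that by (simp add: s universal_toeplitz_def)
  have "b j z1 * a j $$ (0, 0) = b j z2 * a j $$ (0, 0)"
    using entry[of 0 0 z1] entry[of 0 0 z2] n by simp
  moreover have "a j $$ (0, 0) \<noteq> 0"
    using j(2) index[OF j(1), of 0 0 z1] n by auto
  ultimately have "b j z1 = b j z2" by simp
  \<comment> \<open>The entry \<open>(1, 0)\<close> exists because \<open>n \<ge> 2\<close>. There
    \<open>b j z * a j $$ (1, 0)\<close> equals \<open>s\<close> at \<open>z1\<close> and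
    \<open>-s\<close> at \<open>z2\<close>, while \<open>b j\<close> agrees at both points.\<close>
  hence "of_real s = (- of_real s :: complex)"
    using entry[of 1 0 z1] entry[of 1 0 z2] n by (simp add: z)
  hence "s = 0" by (simp add: complex_eq_iff)
  thus False using entry[of 0 0 z1] j(2) index[OF j(1), of 0 0 z1] n by simp
qed

theorem theorem1p10:
  fixes n :: nat
  assumes "n \<ge> 2"
  shows "generates_extremal_ray n (min_cone n) (universal_toeplitz n) \<and>
         universal_toeplitz n \<notin> sep_cone n"
  using assms universal_toeplitz_extremal universal_toeplitz_entangled by simp

end
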